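(* If $G$ is a Roman graph, i.e. a graph with $\gamma_{\rm R}(G)=2\gamma(G)$, then $b_{\rm R}(G)\ge b(G)$.
   Context: Graphs are finite, undirected, without loops or multiple edges; a graph is nonempty if it has at least one edge. $\gamma(G)$ is the domination number of $G$ (minimum cardinality of a vertex set $S$ such that every vertex is in $S$ or adjacent to a vertex of $S$). The bondage number $b(G)$ is the minimum number of edges whose removal from $G$ results in a graph with domination number larger than $\gamma(G)$. A Roman dominating function on $G=(V,E)$ is a function $f:V\to\{0,1,2\}$ such that every vertex $x$ with $f(x)=0$ is adjacent to at least one vertex $y$ with $f(y)=2$. Its weight is $\sum_{u\in V}f(u)$. The Roman domination number $\gamma_{\rm R}(G)$ is the minimum weight of a Roman dominating function on $G$. The Roman bondage number of a nonempty graph $G$ is $b_{\rm R}(G)=\min\{|B|: B\subseteq E(G),\ \gamma_{\rm R}(G-B)>\gamma_{\rm R}(G)\}$, with $b_{\rm R}(G)=\infty$ if no such $B$ exists; here $G-B$ is obtained from $G$ by deleting the edges in $B$ (keeping all vertices). *)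

theory Defs
  imports Main "HOL-Library.Extended_Nat" "HOL-Library.FuncSet"
begin

text \<open>
  A graph is given by its vertex set \<open>V\<close> and its edge set \<open>E\<close>; an edge is the
  two-element set of its endpoints. The graph obtained from \<open>(V, E)\<close> by deleting a set \<open>B\<close> of
  edges and keeping all vertices is \<open>(V, E - B)\<close>.
\<close>

definition simple_graph :: "'a set \<Rightarrow> 'a set set \<Rightarrow> bool" where
  "simple_graph V E \<longleftrightarrow> finite V \<and> (\<forall>e\<in>E. e \<subseteq> V \<and> card e = 2)"

definition adjacent :: "'a set set \<Rightarrow> 'a \<Rightarrow> 'a \<Rightarrow> bool" where
  "adjacent E x y \<longleftrightarrow> {x, y} \<in> E"

definition dominating_set :: "'a set \<Rightarrow> 'a set set \<Rightarrow> 'a set \<Rightarrow> bool" where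
  "dominating_set V E S \<longleftrightarrow> S \<subseteq> V \<and> (\<forall>x\<in>V. x \<in> S \<or> (\<exists>y\<in>S. adjacent E x y))"

text \<open>
  The infima over \<^typ>\<open>nat\<close> below are minima, because they range over nonempty sets: \<open>V\<close> is
  dominating and the constant function \<open>1\<close> is Roman dominating.
\<close>

definition domination_number :: "'a set \<Rightarrow> 'a set set \<Rightarrow> nat" where
  "domination_number V E = Inf {card S | S. dominating_set V E S}"

definition roman_dominating :: "'a set \<Rightarrow> 'a set set \<Rightarrow> ('a \<Rightarrow> nat) \<Rightarrow> bool" where
  "roman_dominating V E f \<longleftrightarrow>
     f \<in> V \<rightarrow> {0, 1, 2} \<and> (\<forall>x\<in>V. f x = 0 \<longrightarrow> (\<exists>y\<in>V. adjacent E x y \<and> f y = 2))"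

definition roman_domination_number :: "'a set \<Rightarrow> 'a set set \<Rightarrow> nat" where
  "roman_domination_number V E = Inf {\<Sum>u\<in>V. f u | f. roman_dominating V E f}"

text \<open>
  In \<^typ>\<open>enat\<close> the infimum of the empty set is \<open>\<infinity>\<close>, and the infimum of a nonempty set
  is its minimum. For a graph with at least one edge the bondage number is finite, since deleting
  all edges raises the domination number; the Roman bondage number may be \<open>\<infinity>\<close>.
\<close>

definition bondage_number :: "'a set \<Rightarrow> 'a set set \<Rightarrow> enat" where
  "bondage_number V E =
     Inf {enat (card B) | B. B \<subseteq> E \<and> domination_number V (E - B) > domination_number V E}"

definition roman_bondage_number :: "'a set \<Rightarrow> 'a set set \<Rightarrow> enat" where
  "roman_bondage_number V E =
     Inf {enat (card B) | B. B \<subseteq> E \<and>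
       roman_domination_number V (E - B) > roman_domination_number V E}"

definition roman_graph :: "'a set \<Rightarrow> 'a set set \<Rightarrow> bool" where
  "roman_graph V E \<longleftrightarrow> roman_domination_number V E = 2 * domination_number V E"

end

theory Submission
  imports Defs
begin

text \<open>
  Placing the value 2 on a minimum dominating set gives \<open>\<gamma>\<^sub>R(H) \<le> 2 \<gamma>(H)\<close> for every finite
  graph \<open>H\<close>. Let \<open>G\<close> be a Roman graph and let deleting \<open>B\<close> raise its Roman domination number.
  Then \<open>2 \<gamma>(G) = \<gamma>\<^sub>R(G) < \<gamma>\<^sub>R(G - B) \<le> 2 \<gamma>(G - B)\<close>, so deleting \<open>B\<close> raises the domination number
  too. The bondage number is therefore an infimum over a larger family of edge sets than
  the Roman bondage number; this includes the case in which the latter is infinite, the infimum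
  of the empty family.
\<close>

lemma ex_minimum_dominating_set:
  obtains S where "dominating_set V E S" and "card S = domination_number V E"
proof -
  have "dominating_set V E V"
    by (simp add: dominating_set_def)
  then have "{card S | S. dominating_set V E S} \<noteq> {}"
    by blast
  then have "domination_number V E \<in> {card S | S. dominating_set V E S}"
    unfolding domination_number_def by (rule Inf_nat_def1)
  then show thesis
    using that by auto
qed

lemma roman_domination_number_le_weight:
  assumes "roman_dominating V E f"
  shows "roman_domination_number V E \<le> (\<Sum>u\<in>V. f u)"
  unfolding roman_domination_number_def using assms by (intro cInf_lower) auto

lemma roman_dominating_of_dominating_set:
  assumes "dominating_set V E S"
  shows "roman_dominating V E (\<lambda>v. if v \<in> S then 2 else 0)"
  using assms unfolding roman_dominating_def dominating_set_def
  by (auto split: if_splits) blast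

lemma roman_domination_number_le_twice_domination_number:
  assumes "finite V"
  shows "roman_domination_number V E \<le> 2 * domination_number V E"
proof -
  obtain S where S: "dominating_set V E S" and card_S: "card S = domination_number V E"
    by (rule ex_minimum_dominating_set)
  have "S \<subseteq> V"
    using S by (simp add: dominating_set_def)
  have "roman_domination_number V E \<le> (\<Sum>v\<in>V. if v \<in> S then 2 else 0)"
    using S by (intro roman_domination_number_le_weight roman_dominating_of_dominating_set)
  also have "\<dots> = (\<Sum>v\<in>V \<inter> S. 2)"
    using assms by (rule sum.inter_restrict[symmetric])
  also have "\<dots> = 2 * domination_number V E"
    using \<open>S \<subseteq> V\<close> card_S by (simp add: Int_absorb1)
  finally show ?thesis .
qed

theorem theorem5p4:
  fixes V :: "'a set" and E :: "'a set set"
  assumes "simple_graph V E"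
    and "E \<noteq> {}"
    and "roman_graph V E"
  shows "roman_bondage_number V E \<ge> bondage_number V E"
proof -
  have "finite V"
    using assms(1) by (simp add: simple_graph_def)
  have "domination_number V (E - B) > domination_number V E"
    if "roman_domination_number V (E - B) > roman_domination_number V E" for B
  proof -
    have "2 * domination_number V E < roman_domination_number V (E - B)"
      using that assms(3) by (simp add: roman_graph_def)
    also have "\<dots> \<le> 2 * domination_number V (E - B)"
      using \<open>finite V\<close> by (rule roman_domination_number_le_twice_domination_number)
    finally show ?thesis
      by simp
  qed
  then show ?thesis
    unfolding bondage_number_def roman_bondage_number_def
    by (intro Inf_superset_mono) blast
qed

end
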